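(* Let $1\le i\le k$, $S=\{i,\ldots,k\}$, and let $\mathrm{Th}^i_k=f_{S,k}$ be the threshold function. Let $p^*\in[0,1]$ be such that $$\alpha(\mathrm{Th}^i_k)=\inf_{\mathcal D_N\in\Delta_k}\left(\frac{\lambda_S(\mathcal D_N,p^* )}{\gamma_{S,k}(\mu(\mathcal D_N))}\right).$$ Then the following randomized algorithm, on input an instance $\Psi$ of $\mathsf{Max\text{-}CSP}(\mathrm{Th}^i_k)$, outputs an assignment whose expected value $\mathrm{val}_\Psi(\cdot)$ is at least $\alpha(\mathrm{Th}^i_k)\cdot\mathrm{val}_\Psi$: assign each variable $x_v$ to $1$ if $\mathrm{diff}_v(\Psi)\ge 0$ and to $-1$ otherwise, and then, independently for each variable, keep its assignment with probability $p^*$ and flip it with probability $1-p^*$.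
   Context: $\mathrm{Th}^i_k(\mathbf x)=1$ iff at least $i$ coordinates of $\mathbf x\in\{-1,1\}^k$ equal $1$. **CSPs.** An $n$-variable instance $\Psi$ of $\mathsf{Max\text{-}CSP}(f)$, $f:\{-1,1\}^k\to\{0,1\}$, is a list of constraints $(\mathbf b(\ell),\mathbf j(\ell))$, $\ell\in[m]$, with non-negative weights $w_\ell$ and total weight $W=\sum_\ell w_\ell>0$, where $\mathbf j(\ell)\in[n]^k$ has distinct entries and $\mathbf b(\ell)\in\{-1,1\}^k$. For $\boldsymbol\sigma\in\{-1,1\}^n$, $\mathrm{val}_\Psi(\boldsymbol\sigma)=\frac1W\sum_\ell w_\ell f(\mathbf b(\ell)\odot\boldsymbol\sigma|_{\mathbf j(\ell)})$, with $\odot$ the coordinatewise product and $\boldsymbol\sigma|_{\mathbf j}=(\sigma_{j_1},\dots,\sigma_{j_k})$; $\mathrm{val}_\Psi=\max_{\boldsymbol\sigma}\mathrm{val}_\Psi(\boldsymbol\sigma)$. For $v\in[n]$, $\mathrm{diff}_v(\Psi)=\sum_{\ell,t:\ j(\ell)_t=v}b(\ell)_t\,w_\ell$. **Ratio $\alpha$.** $\Delta_k$ is the set of probability distributions on $\{-1,1\}^k$ giving equal probability to vectors with the same number of $1$'s. $\mathrm{Bern}(p)$ is $1$ with probability $p$ and $-1$ with probability $1-p$. For $\mathcal D\in\Delta_k$: $\lambda_S(\mathcal D,p)=\mathbb E_{\mathbf a\sim\mathcal D,\mathbf b\sim\mathrm{Bern}(p)^k}[f_{S,k}(\mathbf a\odot\mathbf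 b)]$, $\mu(\mathcal D)=\mathbb E_{\mathbf b\sim\mathcal D}[b_1]$, $\beta_S(\mathcal D)=\sup_{p\in[0,1]}\lambda_S(\mathcal D,p)$, $\gamma_S(\mathcal D)=\lambda_S(\mathcal D,1)$; for $\mu\in[-1,1]$, $\gamma_{S,k}(\mu)=\sup\{\gamma_S(\mathcal D):\mathcal D\in\Delta_k,\ \mu(\mathcal D)=\mu\}$; and $\alpha(f_{S,k})=\inf\frac{\beta_S(\mathcal D_N)}{\gamma_S(\mathcal D_Y)}$ over $\mathcal D_N,\mathcal D_Y\in\Delta_k$ with $\mu(\mathcal D_N)=\mu(\mathcal D_Y)$. Ratios with zero denominator are taken to be $+\infty$. *)

theory Defs
  imports "HOL-Probability.Probability"
begin

section \<open>Sign vectors and symmetric predicates\<close>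

text \<open>Vectors in \<open>{-1,1}^k\<close> are functions on the index set \<open>{1..k}\<close>, extensional
  (\<open>undefined\<close> outside it), so that each vector has exactly one representation.\<close>

definition cube :: "nat \<Rightarrow> (nat \<Rightarrow> int) set" where
  "cube k = {1..k} \<rightarrow>\<^sub>E {-1, 1}"

definition hadamard :: "nat \<Rightarrow> (nat \<Rightarrow> int) \<Rightarrow> (nat \<Rightarrow> int) \<Rightarrow> nat \<Rightarrow> int" where
  "hadamard k x y = (\<lambda>t\<in>{1..k}. x t * y t)"

definition num_ones :: "nat \<Rightarrow> (nat \<Rightarrow> int) \<Rightarrow> nat" where
  "num_ones k x = card {t \<in> {1..k}. x t = 1}"

text \<open>The symmetric predicate \<open>f\<^bsub>S,k\<^esub>\<close>.\<close>

definition sym_pred :: "nat set \<Rightarrow> nat \<Rightarrow> (nat \<Rightarrow> int) \<Rightarrow> real" where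
  "sym_pred S k x = (if num_ones k x \<in> S then 1 else 0)"

definition Th :: "nat \<Rightarrow> nat \<Rightarrow> (nat \<Rightarrow> int) \<Rightarrow> real" where
  "Th i k x = (if i \<le> num_ones k x then 1 else 0)"

lemma num_ones_le: "num_ones k x \<le> k"
proof -
  have "card {t \<in> {1..k}. x t = 1} \<le> card {1..k}"
    by (rule card_mono) auto
  then show ?thesis by (simp add: num_ones_def)
qed

lemma Th_eq_sym_pred: "Th i k = sym_pred {i..k} k"
  by (auto simp: Th_def sym_pred_def num_ones_le fun_eq_iff)


section \<open>Weighted Max-CSP instances\<close>

text \<open>The \<open>num_cons\<close> constraints are indexed by \<open>l \<in> {1..num_cons \<Psi>}\<close>; the fields
  \<open>signs\<close>, \<open>vars\<close> and \<open>weight\<close> are \<open>b(l)\<close>, \<open>j(l)\<close> and \<open>w\<^sub>l\<close>.\<close>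

record csp =
  num_cons :: nat
  signs :: "nat \<Rightarrow> nat \<Rightarrow> int"
  vars :: "nat \<Rightarrow> nat \<Rightarrow> nat"
  weight :: "nat \<Rightarrow> real"

definition total_weight :: "csp \<Rightarrow> real" where
  "total_weight \<Psi> = (\<Sum>l\<in>{1..num_cons \<Psi>}. weight \<Psi> l)"

definition csp_instance :: "nat \<Rightarrow> nat \<Rightarrow> csp \<Rightarrow> bool" where
  "csp_instance n k \<Psi> \<longleftrightarrow>
     (\<forall>l\<in>{1..num_cons \<Psi>}.
        signs \<Psi> l \<in> cube k \<and>
        vars \<Psi> l \<in> {1..k} \<rightarrow>\<^sub>E {1..n} \<and> inj_on (vars \<Psi> l) {1..k} \<and>
        weight \<Psi> l \<ge> 0) \<and>
     total_weight \<Psi> > 0"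

definition csp_val :: "nat \<Rightarrow> ((nat \<Rightarrow> int) \<Rightarrow> real) \<Rightarrow> csp \<Rightarrow> (nat \<Rightarrow> int) \<Rightarrow> real" where
  "csp_val k f \<Psi> \<sigma> =
     1 / total_weight \<Psi> *
     (\<Sum>l\<in>{1..num_cons \<Psi>}.
        weight \<Psi> l * f (hadamard k (signs \<Psi> l) (\<lambda>t\<in>{1..k}. \<sigma> (vars \<Psi> l t))))"

definition csp_max_val :: "nat \<Rightarrow> nat \<Rightarrow> ((nat \<Rightarrow> int) \<Rightarrow> real) \<Rightarrow> csp \<Rightarrow> real" where
  "csp_max_val n k f \<Psi> = Max (csp_val k f \<Psi> ` cube n)"

definition diff :: "nat \<Rightarrow> csp \<Rightarrow> nat \<Rightarrow> real" where
  "diff k \<Psi> v =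
     (\<Sum>(l, t) \<in> {(l, t). l \<in> {1..num_cons \<Psi>} \<and> t \<in> {1..k} \<and> vars \<Psi> l t = v}.
        real_of_int (signs \<Psi> l t) * weight \<Psi> l)"


section \<open>The approximation ratio\<close>

definition Bern :: "real \<Rightarrow> int pmf" where
  "Bern p = map_pmf (\<lambda>c. if c then 1 else -1) (bernoulli_pmf p)"

text \<open>The default value \<open>undefined\<close> makes the samples extensional, i.e. elements of \<open>cube k\<close>.\<close>

definition Bern_vec :: "nat \<Rightarrow> real \<Rightarrow> (nat \<Rightarrow> int) pmf" where
  "Bern_vec k p = Pi_pmf {1..k} undefined (\<lambda>_. Bern p)"

definition Delta :: "nat \<Rightarrow> (nat \<Rightarrow> int) pmf set" where
  "Delta k = {D. set_pmf D \<subseteq> cube k \<and>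
     (\<forall>x\<in>cube k. \<forall>y\<in>cube k. num_ones k x = num_ones k y \<longrightarrow> pmf D x = pmf D y)}"

definition lam :: "nat set \<Rightarrow> nat \<Rightarrow> (nat \<Rightarrow> int) pmf \<Rightarrow> real \<Rightarrow> real" where
  "lam S k D p =
     measure_pmf.expectation (pair_pmf D (Bern_vec k p))
       (\<lambda>(a, b). sym_pred S k (hadamard k a b))"

definition mu :: "(nat \<Rightarrow> int) pmf \<Rightarrow> real" where
  "mu D = measure_pmf.expectation D (\<lambda>b. real_of_int (b 1))"

definition beta :: "nat set \<Rightarrow> nat \<Rightarrow> (nat \<Rightarrow> int) pmf \<Rightarrow> real" where
  "beta S k D = (SUP p\<in>{0..1}. lam S k D p)"

definition gamma :: "nat set \<Rightarrow> nat \<Rightarrow> (nat \<Rightarrow> int) pmf \<Rightarrow> real" where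
  "gamma S k D = lam S k D 1"

definition gamma_mu :: "nat set \<Rightarrow> nat \<Rightarrow> real \<Rightarrow> real" where
  "gamma_mu S k m = (SUP D\<in>{D \<in> Delta k. mu D = m}. gamma S k D)"

text \<open>Library division has \<open>a / 0 = 0\<close> on \<open>real\<close> (and \<open>0 / 0 = 0\<close> on \<open>ereal\<close>), whereas
  here every ratio with zero denominator is \<open>+\<infinity>\<close>.\<close>

definition ratio :: "real \<Rightarrow> real \<Rightarrow> ereal" where
  "ratio a b = (if b = 0 then \<infinity> else ereal (a / b))"

definition alpha :: "nat set \<Rightarrow> nat \<Rightarrow> ereal" where
  "alpha S k =
     (INF (DN, DY) \<in> {(DN, DY). DN \<in> Delta k \<and> DY \<in> Delta k \<and> mu DN = mu DY}.
        ratio (beta S k DN) (gamma S k DY))"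


section \<open>The rounding algorithm\<close>

definition majority_assignment :: "nat \<Rightarrow> csp \<Rightarrow> nat \<Rightarrow> int" where
  "majority_assignment k \<Psi> v = (if diff k \<Psi> v \<ge> 0 then 1 else -1)"

text \<open>The distribution of the output assignment; the coin \<open>keep\<close> is tossed
  independently for each variable.\<close>

definition rounding :: "nat \<Rightarrow> nat \<Rightarrow> real \<Rightarrow> csp \<Rightarrow> (nat \<Rightarrow> int) pmf" where
  "rounding n k p \<Psi> =
     Pi_pmf {1..n} undefined
       (\<lambda>v. map_pmf (\<lambda>keep. if keep then majority_assignment k \<Psi> v
                                     else - majority_assignment k \<Psi> v)
              (bernoulli_pmf p))"

end

theory Submission
  imports Defs
begin

text \<open>For an assignment \<open>\<sigma>\<close>, draw a constraint \<open>l\<close> with probability proportional to its weight and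
  symmetrize \<open>b(l) \<odot> \<sigma>|\<^bsub>j(l)\<^esub>\<close> over all vectors with the same number of ones; call the resulting
  distribution \<open>D(\<sigma>) \<in> \<Delta>\<^sub>k\<close>. Since the predicate is symmetric, flipping each coordinate of \<open>\<sigma>\<close> with
  probability \<open>1 - p\<close> yields expected value \<open>\<lambda>\<^sub>S(D(\<sigma>), p)\<close>, and \<open>\<gamma>\<^sub>S(D(\<sigma>))\<close> is the value of \<open>\<sigma>\<close>. As
  \<open>\<mu>(D(\<sigma>))\<close> is proportional to \<open>\<Sum>\<^sub>v \<sigma>\<^sub>v diff\<^sub>v\<close>, it is maximized by the majority assignment. Finally
  \<open>\<gamma>\<^bsub>S,k\<^esub>\<close> is monotone for threshold predicates, because mixing a distribution with the all-ones
  vector increases both \<open>\<mu>\<close> and \<open>\<gamma>\<^sub>S\<close>; so the optimum is at most \<open>\<gamma>\<^bsub>S,k\<^esub>\<close> at the mean of the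
  majority assignment.\<close>

section \<open>Sign vectors and their levels under coordinate permutations\<close>

lemma finite_cube: "finite (cube k)"
  by (simp add: cube_def finite_PiE)

lemma cube_val: "x \<in> cube k \<Longrightarrow> t \<in> {1..k} \<Longrightarrow> x t = -1 \<or> x t = 1"
  by (auto simp: cube_def PiE_iff)

lemma cube_comp_permutes:
  assumes "x \<in> cube k" "\<pi> permutes {1..k}"
  shows "x \<circ> \<pi> \<in> cube k"
  using assms permutes_in_image[OF assms(2)] permutes_not_in[OF assms(2)]
  by (auto simp: cube_def PiE_iff extensional_def)

lemma num_ones_comp_permutes:
  assumes "\<pi> permutes {1..k}"
  shows "num_ones k (x \<circ> \<pi>) = num_ones k x"
  unfolding num_ones_def
proof (rule bij_betw_same_card)
  show "bij_betw \<pi> {t \<in> {1..k}. (x \<circ> \<pi>) t = 1} {t \<in> {1..k}. x t = 1}"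
  proof (rule bij_betw_byWitness[where f' = "inv \<pi>"])
    show "\<pi> ` {t \<in> {1..k}. (x \<circ> \<pi>) t = 1} \<subseteq> {t \<in> {1..k}. x t = 1}"
      using permutes_in_image[OF assms] by auto
    show "inv \<pi> ` {t \<in> {1..k}. x t = 1} \<subseteq> {t \<in> {1..k}. (x \<circ> \<pi>) t = 1}"
      using permutes_in_image[OF permutes_inv[OF assms]] permutes_inverses[OF assms] by auto
  qed (use permutes_inverses[OF assms] in auto)
qed

text \<open>Glue a bijection between the positions of \<open>1\<close> with one between the
  positions of \<open>-1\<close>. Each level of the cube is thus a single orbit of coordinate
  permutations.\<close>

lemma permutes_if_num_ones_eq:
  assumes x: "x \<in> cube k" and y: "y \<in> cube k" and eq: "num_ones k x = num_ones k y"
  obtains \<pi> where "\<pi> permutes {1..k}" "x = y \<circ> \<pi>"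
proof -
  define A where "A z = {t \<in> {1..k}. z t = (1::int)}" for z
  have fin: "finite (A z)" for z by (simp add: A_def)
  have sub: "A z \<subseteq> {1..k}" for z by (auto simp: A_def)
  have c1: "card (A x) = card (A y)" using eq by (simp add: num_ones_def A_def)
  have c2: "card ({1..k} - A x) = card ({1..k} - A y)"
    using c1 sub fin by (simp add: card_Diff_subset)
  obtain f where f: "bij_betw f (A x) (A y)"
    using finite_same_card_bij[OF fin fin c1] by blast
  obtain g where g: "bij_betw g ({1..k} - A x) ({1..k} - A y)"
    using finite_same_card_bij[OF _ _ c2] by blast
  define \<pi> where "\<pi> t = (if t \<in> A x then f t else if t \<in> {1..k} then g t else t)" for t
  have "bij_betw \<pi> (A x) (A y)"
    using f by (rule bij_betw_cong[THEN iffD1, rotated]) (simp add: \<pi>_def)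
  moreover have "bij_betw \<pi> ({1..k} - A x) ({1..k} - A y)"
    using g by (rule bij_betw_cong[THEN iffD1, rotated]) (simp add: \<pi>_def)
  ultimately have "bij_betw \<pi> (A x \<union> ({1..k} - A x)) (A y \<union> ({1..k} - A y))"
    by (rule bij_betw_combine) auto
  then have "bij_betw \<pi> {1..k} {1..k}"
    using sub by (simp add: Un_absorb1)
  then have perm: "\<pi> permutes {1..k}"
    using sub[of x] by (intro bij_imp_permutes) (auto simp: \<pi>_def)
  have "x t = y (\<pi> t)" for t
  proof -
    consider "t \<in> A x" | "t \<in> {1..k} - A x" | "t \<notin> {1..k}" by blast
    then show ?thesis
    proof cases
      case 1
      then have "f t \<in> A y" using f by (auto simp: bij_betw_def)
      with 1 show ?thesis by (simp add: \<pi>_def A_def)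
    next
      case 2
      then have "g t \<in> {1..k} - A y" using g by (auto simp: bij_betw_def)
      with 2 show ?thesis using cube_val[OF x, of t] cube_val[OF y, of "g t"]
        by (auto simp: \<pi>_def A_def)
    next
      case 3
      \<comment> \<open>Here \<open>\<pi>\<close> fixes \<open>t\<close>, and both vectors are
        \<open>undefined\<close> there by extensionality.\<close>
      then show ?thesis using x y sub[of x] by (auto simp: \<pi>_def cube_def PiE_iff extensional_def)
    qed
  qed
  then show thesis using that[OF perm] by (simp add: fun_eq_iff)
qed

lemma sum_cube:
  assumes "x \<in> cube k"
  shows "(\<Sum>t\<in>{1..k}. x t) = 2 * int (num_ones k x) - int k"
proof -
  have "(\<Sum>t\<in>{1..k}. x t) = (\<Sum>t\<in>{1..k}. 2 * (if x t = 1 then 1 else 0) - 1)"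
    by (intro sum.cong refl) (use cube_val[OF assms] in force)
  also have "\<dots> = 2 * (\<Sum>t\<in>{1..k}. if x t = 1 then 1 else 0) - int k"
    by (simp add: sum_subtractf sum_distrib_left)
  also have "(\<Sum>t\<in>{1..k}. if x t = 1 then 1 else 0) = int (num_ones k x)"
    by (simp add: num_ones_def sum.If_cases Int_def)
  finally show ?thesis .
qed

section \<open>Bernoulli noise on sign vectors\<close>

lemma set_Bern_vec: "set_pmf (Bern_vec k p) \<subseteq> cube k"
proof -
  have "set_pmf (Bern p) \<subseteq> {-1, 1}" by (auto simp: Bern_def)
  then show ?thesis
    by (auto simp: Bern_vec_def set_Pi_pmf cube_def PiE_dflt_def PiE_iff extensional_def)
qed

lemma hadamard_in_cube:
  assumes "x \<in> cube k" "\<And>t. t \<in> {1..k} \<Longrightarrow> y t \<in> {-1, 1}"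
  shows "hadamard k x y \<in> cube k"
  using cube_val[OF assms(1)] assms(2) by (fastforce simp: cube_def hadamard_def PiE_iff)

text \<open>The expectation over \<open>b\<close> inside \<open>lam\<close> with \<open>a\<close>
  held fixed, separated from the distribution of \<open>a\<close> so that the latter can be
  symmetrized.\<close>

definition noisy_value :: "nat set \<Rightarrow> nat \<Rightarrow> real \<Rightarrow> (nat \<Rightarrow> int) \<Rightarrow> real" where
  "noisy_value S k p a =
     measure_pmf.expectation (Bern_vec k p) (\<lambda>b. sym_pred S k (hadamard k a b))"

text \<open>The coordinates of the noise are independent and identically distributed, so its law is
  invariant under the permutation carrying one vector to the other. Permuting both factors permutes
  the product and preserves its number of ones.\<close>

lemma noisy_value_cong:
  assumes "x \<in> cube k" "y \<in> cube k" "num_ones k x = num_ones k y"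
  shows "noisy_value S k p x = noisy_value S k p y"
proof -
  obtain \<pi> where \<pi>: "\<pi> permutes {1..k}" "x = y \<circ> \<pi>"
    using permutes_if_num_ones_eq[OF assms] .
  have "Bern_vec k p = map_pmf (\<lambda>g. g \<circ> \<pi>) (Bern_vec k p)"
    unfolding Bern_vec_def
    by (rule Pi_pmf_bij_betw) (use permutes_imp_bij[OF \<pi>(1)] permutes_in_image[OF \<pi>(1)] in auto)
  then have "noisy_value S k p x =
      measure_pmf.expectation (map_pmf (\<lambda>g. g \<circ> \<pi>) (Bern_vec k p))
        (\<lambda>b. sym_pred S k (hadamard k x b))"
    unfolding noisy_value_def by simp
  also have "\<dots> = noisy_value S k p y"
  proof -
    have "hadamard k x (g \<circ> \<pi>) = hadamard k y g \<circ> \<pi>" for g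
      using \<pi> permutes_in_image[OF \<pi>(1)] by (auto simp: hadamard_def fun_eq_iff)
    then show ?thesis
      by (simp add: noisy_value_def sym_pred_def num_ones_comp_permutes[OF \<pi>(1)])
  qed
  finally show ?thesis .
qed

lemma noisy_value_1:
  assumes "x \<in> cube k"
  shows "noisy_value S k 1 x = sym_pred S k x"
proof -
  have "Bern 1 = return_pmf 1" by (intro pmf_eqI) (simp add: Bern_def map_pmf_def pmf_bind)
  then have "Bern_vec k 1 = return_pmf (\<lambda>t. if t \<in> {1..k} then 1 else undefined)"
    by (simp add: Bern_vec_def Pi_pmf_return_pmf)
  moreover have "hadamard k x (\<lambda>t. if t \<in> {1..k} then 1 else undefined) = x"
    using assms by (auto simp: hadamard_def cube_def PiE_iff extensional_def fun_eq_iff)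
  ultimately show ?thesis by (simp add: noisy_value_def)
qed

text \<open>\<open>a\<close> and \<open>b\<close> are independent, so the noise can be integrated
  out first; finiteness of the cube turns both integrals into sums.\<close>

lemma lam_eq_expectation:
  assumes "set_pmf D \<subseteq> cube k"
  shows "lam S k D p = measure_pmf.expectation D (noisy_value S k p)"
proof -
  have fin: "finite (set_pmf (Bern_vec k p))"
    by (rule finite_subset[OF set_Bern_vec finite_cube])
  have "lam S k D p = (\<Sum>a\<in>cube k. pmf D a *\<^sub>R
          measure_pmf.expectation (map_pmf (Pair a) (Bern_vec k p))
            (\<lambda>(a, b). sym_pred S k (hadamard k a b)))"
    unfolding lam_def pair_pmf_def map_pmf_def[symmetric]
    using assms fin by (intro pmf_expectation_bind finite_cube) auto
  also have "\<dots> = measure_pmf.expectation D (noisy_value S k p)"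
    using assms by (subst integral_measure_pmf[OF finite_cube, of D]) (auto simp: noisy_value_def)
  finally show ?thesis .
qed

lemma gamma_eq_expectation:
  assumes "set_pmf D \<subseteq> cube k"
  shows "gamma S k D = measure_pmf.expectation D (sym_pred S k)"
  unfolding gamma_def lam_eq_expectation[OF assms]
  by (rule integral_cong_AE) (use assms noisy_value_1 in \<open>auto simp: AE_measure_pmf_iff\<close>)

lemma gamma_le_1: "set_pmf D \<subseteq> cube k \<Longrightarrow> gamma S k D \<le> 1"
  unfolding gamma_eq_expectation
  by (rule measure_pmf.integral_le_const)
     (auto simp: sym_pred_def intro!: measure_pmf.integrable_const_bound[where B = 1])

lemma lam_nonneg: "0 \<le> lam S k D p"
  by (auto simp: lam_def sym_pred_def intro!: integral_nonneg_AE)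

lemma set_pmf_Delta: "D \<in> Delta k \<Longrightarrow> set_pmf D \<subseteq> cube k"
  unfolding Delta_def by blast

subsection \<open>Symmetrization\<close>

definition level :: "nat \<Rightarrow> nat \<Rightarrow> (nat \<Rightarrow> int) set" where
  "level k m = {x \<in> cube k. num_ones k x = m}"

text \<open>For \<open>Q\<close> on the cube this averages over coordinate permutations, a level
  being one orbit, and preserves the law of \<open>num_ones k\<close>.\<close>

definition symmetrize :: "nat \<Rightarrow> (nat \<Rightarrow> int) pmf \<Rightarrow> (nat \<Rightarrow> int) pmf" where
  "symmetrize k Q = bind_pmf Q (\<lambda>x. pmf_of_set (level k (num_ones k x)))"

lemma finite_level: "finite (level k m)"
  by (simp add: level_def finite_cube)

lemma level_self: "x \<in> cube k \<Longrightarrow> x \<in> level k (num_ones k x)"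
  by (simp add: level_def)

lemma set_level_pmf:
  "x \<in> cube k \<Longrightarrow> set_pmf (pmf_of_set (level k (num_ones k x))) = level k (num_ones k x)"
  using level_self[of x k] by (intro set_pmf_of_set finite_level) auto

lemma symmetrize_in_Delta:
  assumes "set_pmf Q \<subseteq> cube k"
  shows "symmetrize k Q \<in> Delta k"
proof -
  have "set_pmf (symmetrize k Q) \<subseteq> cube k"
    unfolding symmetrize_def set_bind_pmf
  proof (rule UN_least)
    fix x assume "x \<in> set_pmf Q"
    then show "set_pmf (pmf_of_set (level k (num_ones k x))) \<subseteq> cube k"
      using assms by (subst set_level_pmf) (auto simp: level_def)
  qed
  moreover have "pmf (symmetrize k Q) x = pmf (symmetrize k Q) y"
    if "x \<in> cube k" "y \<in> cube k" "num_ones k x = num_ones k y" for x y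
    unfolding symmetrize_def pmf_bind
  proof (rule integral_cong_AE)
    show "AE z in measure_pmf Q. pmf (pmf_of_set (level k (num_ones k z))) x =
                                 pmf (pmf_of_set (level k (num_ones k z))) y"
    proof (rule AE_pmfI)
      fix z assume "z \<in> set_pmf Q"
      \<comment> \<open>Only on a nonempty set is \<open>pmf_of_set\<close> known to be uniform;
        \<open>x\<close> and \<open>y\<close> then lie both inside or both outside the level of
        \<open>z\<close>.\<close>
      then have "level k (num_ones k z) \<noteq> {}" using assms level_self by blast
      then show "pmf (pmf_of_set (level k (num_ones k z))) x =
                 pmf (pmf_of_set (level k (num_ones k z))) y"
        using that by (simp add: finite_level) (simp add: level_def indicator_def)
    qed
  qed auto
  ultimately show ?thesis unfolding Delta_def by blast
qed

text \<open>Iterated expectation: the second hypothesis says, with the denominator cleared, that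
  \<open>h x\<close> is the average of \<open>g\<close> over the level of \<open>x\<close>.\<close>

lemma expectation_symmetrize:
  fixes g h :: "(nat \<Rightarrow> int) \<Rightarrow> real"
  assumes Q: "set_pmf Q \<subseteq> cube k"
    and "\<And>x. x \<in> cube k \<Longrightarrow>
      (\<Sum>y\<in>level k (num_ones k x). g y) = card (level k (num_ones k x)) * h x"
  shows "measure_pmf.expectation (symmetrize k Q) g = measure_pmf.expectation Q h"
proof -
  have "measure_pmf.expectation (symmetrize k Q) g = (\<Sum>x\<in>cube k. pmf Q x *\<^sub>R
          measure_pmf.expectation (pmf_of_set (level k (num_ones k x))) g)"
    unfolding symmetrize_def
    by (intro pmf_expectation_bind finite_cube Q) (simp add: set_level_pmf finite_level)
  also have "\<dots> = (\<Sum>x\<in>cube k. pmf Q x *\<^sub>R h x)"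
  proof (intro sum.cong refl arg_cong2[where f = scaleR])
    fix x assume x: "x \<in> cube k"
    then have ne: "level k (num_ones k x) \<noteq> {}" using level_self by blast
    then show "measure_pmf.expectation (pmf_of_set (level k (num_ones k x))) g = h x"
      using assms(2)[OF x] by (simp add: integral_pmf_of_set finite_level)
  qed
  also have "\<dots> = measure_pmf.expectation Q h"
    using Q by (subst integral_measure_pmf[OF finite_cube, of Q]) auto
  finally show ?thesis .
qed

text \<open>The noisy value is constant on levels, so resampling within a level leaves its
  expectation unchanged.\<close>

lemma lam_symmetrize:
  assumes "set_pmf Q \<subseteq> cube k"
  shows "lam S k (symmetrize k Q) p = measure_pmf.expectation Q (noisy_value S k p)"
proof -
  have "set_pmf (symmetrize k Q) \<subseteq> cube k"
    using symmetrize_in_Delta[OF assms] by (rule set_pmf_Delta)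
  moreover have "measure_pmf.expectation (symmetrize k Q) (noisy_value S k p) =
                 measure_pmf.expectation Q (noisy_value S k p)"
  proof (rule expectation_symmetrize[OF assms])
    fix x assume x: "x \<in> cube k"
    have "(\<Sum>y\<in>level k (num_ones k x). noisy_value S k p y) =
          (\<Sum>y\<in>level k (num_ones k x). noisy_value S k p x)"
      by (intro sum.cong refl noisy_value_cong) (use x in \<open>auto simp: level_def\<close>)
    then show "(\<Sum>y\<in>level k (num_ones k x). noisy_value S k p y) =
          card (level k (num_ones k x)) * noisy_value S k p x"
      by simp
  qed
  ultimately show ?thesis by (simp add: lam_eq_expectation)
qed

text \<open>Swapping the coordinates \<open>s\<close> and \<open>t\<close> is an involution of the
  level.\<close>

lemma sum_level_coordinate:
  assumes "s \<in> {1..k}" "t \<in> {1..k}"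
  shows "(\<Sum>y\<in>level k m. y s) = (\<Sum>y\<in>level k m. y t)"
proof -
  have perm: "Transposition.transpose s t permutes {1..k}"
    using assms by (rule permutes_swap_id)
  have "y \<circ> Transposition.transpose s t \<in> level k m" if "y \<in> level k m" for y
    using that cube_comp_permutes[OF _ perm] num_ones_comp_permutes[OF perm]
    by (simp add: level_def)
  then show ?thesis
    by (intro sum.reindex_bij_witness[where i = "\<lambda>y. y \<circ> Transposition.transpose s t"
          and j = "\<lambda>y. y \<circ> Transposition.transpose s t"])
       (auto simp: comp_assoc)
qed

text \<open>Within a level all coordinates have the same mean, so the first contributes
  \<open>1/k\<close> of the coordinate sum, and that sum depends only on the number of ones.\<close>

lemma mu_symmetrize:
  assumes "set_pmf Q \<subseteq> cube k" "1 \<le> k"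
  shows "mu (symmetrize k Q) =
    measure_pmf.expectation Q (\<lambda>x. real_of_int (\<Sum>t\<in>{1..k}. x t) / k)"
  unfolding mu_def
proof (rule expectation_symmetrize[OF assms(1)])
  fix x assume x: "x \<in> cube k"
  let ?L = "level k (num_ones k x)"
  have "int k * (\<Sum>y\<in>?L. y 1) = (\<Sum>t\<in>{1..k}. \<Sum>y\<in>?L. y 1)"
    by simp
  also have "\<dots> = (\<Sum>t\<in>{1..k}. \<Sum>y\<in>?L. y t)"
    using assms(2) by (intro sum.cong refl sum_level_coordinate) auto
  also have "\<dots> = (\<Sum>y\<in>?L. \<Sum>t\<in>{1..k}. y t)"
    by (rule sum.swap)
  also have "\<dots> = (\<Sum>y\<in>?L. \<Sum>t\<in>{1..k}. x t)"
    by (rule sum.cong[OF refl]) (simp only: level_def mem_Collect_eq sum_cube x)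
  finally have "int k * (\<Sum>y\<in>?L. y 1) = int (card ?L) * (\<Sum>t\<in>{1..k}. x t)"
    by simp
  then have "real k * real_of_int (\<Sum>y\<in>?L. y 1) =
      real (card ?L) * real_of_int (\<Sum>t\<in>{1..k}. x t)"
    by (metis of_int_mult of_int_of_nat_eq)
  then show "(\<Sum>y\<in>?L. real_of_int (y 1)) = card ?L * (real_of_int (\<Sum>t\<in>{1..k}. x t) / k)"
    using assms(2) by (simp add: field_simps)
qed

subsection \<open>Monotonicity of the optimal value\<close>

lemma mu_le_1:
  assumes "set_pmf D \<subseteq> cube k" "1 \<le> k"
  shows "mu D \<le> 1"
  unfolding mu_def
proof (rule measure_pmf.integral_le_const)
  have *: "b 1 = -1 \<or> b 1 = 1" if "b \<in> set_pmf D" for b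
    using assms that cube_val[of b k 1] by auto
  show "integrable (measure_pmf D) (\<lambda>b. real_of_int (b 1))"
    by (rule measure_pmf.integrable_const_bound[where B = 1])
       (use * in \<open>force simp: AE_measure_pmf_iff\<close>)+
  show "AE b in measure_pmf D. real_of_int (b 1) \<le> 1"
    using * by (force simp: AE_measure_pmf_iff)
qed

text \<open>A real supremum bounds its members only when the set is bounded above; the bound
  \<open>1\<close> serves here.\<close>

lemma gamma_le_gamma_mu:
  assumes "D \<in> Delta k"
  shows "gamma S k D \<le> gamma_mu S k (mu D)"
  unfolding gamma_mu_def
proof (rule cSUP_upper)
  show "bdd_above (gamma S k ` {D' \<in> Delta k. mu D' = mu D})"
    by (rule bdd_aboveI[of _ 1]) (auto intro: gamma_le_1 dest: set_pmf_Delta)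
qed (use assms in simp)

definition all_ones :: "nat \<Rightarrow> nat \<Rightarrow> int" where
  "all_ones k = (\<lambda>t\<in>{1..k}. 1)"

lemma all_ones_in_cube: "all_ones k \<in> cube k"
  by (simp add: all_ones_def cube_def)

lemma num_ones_all_ones: "num_ones k (all_ones k) = k"
proof -
  have "{t \<in> {1..k}. all_ones k t = 1} = {1..k}" by (auto simp: all_ones_def)
  then show ?thesis by (simp add: num_ones_def)
qed

text \<open>The top level is a singleton, so a point mass at \<open>all_ones k\<close> respects the
  symmetry required by \<open>Delta k\<close>.\<close>

lemma eq_all_ones_if_num_ones:
  assumes "x \<in> cube k" "num_ones k x = k"
  shows "x = all_ones k"
proof -
  obtain \<pi> where \<pi>: "\<pi> permutes {1..k}" "x = all_ones k \<circ> \<pi>"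
    using permutes_if_num_ones_eq[OF assms(1) all_ones_in_cube] assms(2) num_ones_all_ones
    by metis
  then show ?thesis
    using permutes_in_image[OF \<pi>(1)] by (auto simp: all_ones_def fun_eq_iff)
qed

text \<open>Mix \<open>D\<close> with the point mass at \<open>all_ones k\<close> until the mean
  reaches \<open>m\<close>. The predicate holds at that vector because \<open>i \<le> k\<close>, so
  its expectation cannot drop.\<close>

lemma gamma_le_gamma_mu_mono:
  assumes D: "D \<in> Delta k" and k: "i \<le> k" "1 \<le> k" and m: "mu D \<le> m" "m \<le> 1"
  shows "gamma {i..k} k D \<le> gamma_mu {i..k} k m"
proof (cases "mu D = m")
  case True
  then show ?thesis using gamma_le_gamma_mu[OF D] by blast
next
  case False
  \<comment> \<open>The weight of \<open>D\<close> that solves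
    \<open>q * mu D + (1 - q) = m\<close>; in this case \<open>mu D < m \<le> 1\<close>, so the
    denominator is positive.\<close>
  define q where "q = (1 - m) / (1 - mu D)"
  have q: "0 \<le> q" "q \<le> 1" using False m by (auto simp: q_def)
  have "q * (1 - mu D) = 1 - m" using False m by (simp add: q_def)
  then have q_eq: "q * mu D + (1 - q) = m" by (simp add: algebra_simps)
  define E where "E = bind_pmf (bernoulli_pmf q) (\<lambda>c. if c then D else return_pmf (all_ones k))"
  have D_cube: "set_pmf D \<subseteq> cube k" using D by (rule set_pmf_Delta)
  have E_cube: "set_pmf E \<subseteq> cube k"
    using D_cube all_ones_in_cube by (auto simp: E_def split: if_splits)
  have pmf_E: "pmf E x = q * pmf D x + (1 - q) * indicator {all_ones k} x" for x
    using q by (simp add: E_def pmf_bind indicator_def)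
  have expect: "measure_pmf.expectation E g = q * measure_pmf.expectation D g + (1 - q) * g (all_ones k)"
    for g :: "_ \<Rightarrow> real"
  proof -
    have "measure_pmf.expectation E g = (\<Sum>c\<in>UNIV. pmf (bernoulli_pmf q) c *\<^sub>R
        measure_pmf.expectation (if c then D else return_pmf (all_ones k)) g)"
      unfolding E_def
      by (rule pmf_expectation_bind) (use finite_subset[OF D_cube finite_cube] in auto)
    then show ?thesis using q by (simp add: UNIV_bool)
  qed
  have "E \<in> Delta k"
  proof -
    have "pmf E x = pmf E y"
      if xy: "x \<in> cube k" "y \<in> cube k" "num_ones k x = num_ones k y" for x y
    proof -
      have "(x = all_ones k) = (y = all_ones k)"
        using xy eq_all_ones_if_num_ones num_ones_all_ones by metis
      moreover have "pmf D x = pmf D y" using D xy unfolding Delta_def by blast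
      ultimately show ?thesis unfolding pmf_E by (simp add: indicator_def)
    qed
    then show ?thesis unfolding Delta_def using E_cube by blast
  qed
  moreover have "mu E = m"
    using k q_eq by (simp add: mu_def expect all_ones_def)
  moreover have "gamma {i..k} k D \<le> gamma {i..k} k E"
  proof -
    have "gamma {i..k} k E = q * gamma {i..k} k D + (1 - q)"
      using k D_cube E_cube
      by (simp add: gamma_eq_expectation expect sym_pred_def num_ones_all_ones)
    moreover have "0 \<le> (1 - q) * (1 - gamma {i..k} k D)"
      using q gamma_le_1[OF D_cube] by simp
    ultimately show ?thesis by (simp add: algebra_simps)
  qed
  ultimately show ?thesis using gamma_le_gamma_mu[of E k "{i..k}"] by simp
qed

subsection \<open>The distribution of a random constraint\<close>

text \<open>A genuine distribution only for nonnegative weights of positive total, which is what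
  \<open>csp_instance\<close> provides.\<close>

definition constraint_pmf :: "csp \<Rightarrow> nat pmf" where
  "constraint_pmf \<Psi> =
     embed_pmf (\<lambda>l. if l \<in> {1..num_cons \<Psi>} then weight \<Psi> l / total_weight \<Psi> else 0)"

definition literals :: "nat \<Rightarrow> csp \<Rightarrow> (nat \<Rightarrow> int) \<Rightarrow> nat \<Rightarrow> nat \<Rightarrow> int" where
  "literals k \<Psi> \<sigma> l = hadamard k (signs \<Psi> l) (\<lambda>t\<in>{1..k}. \<sigma> (vars \<Psi> l t))"

definition literal_pmf :: "nat \<Rightarrow> csp \<Rightarrow> (nat \<Rightarrow> int) \<Rightarrow> (nat \<Rightarrow> int) pmf" where
  "literal_pmf k \<Psi> \<sigma> = map_pmf (literals k \<Psi> \<sigma>) (constraint_pmf \<Psi>)"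

text \<open>Keeping or flipping a variable is written as multiplication by a random sign, so that
  the noise has the same form as in \<open>lam\<close>.\<close>

definition flip :: "nat \<Rightarrow> real \<Rightarrow> (nat \<Rightarrow> int) \<Rightarrow> (nat \<Rightarrow> int) pmf" where
  "flip n p \<sigma> = Pi_pmf {1..n} undefined (\<lambda>v. map_pmf (\<lambda>c. \<sigma> v * c) (Bern p))"

lemma rounding_eq_flip: "rounding n k p \<Psi> = flip n p (majority_assignment k \<Psi>)"
  unfolding rounding_def flip_def Bern_def pmf.map_comp
  by (intro arg_cong[where f = "Pi_pmf {1..n} undefined"] ext map_pmf_cong) auto

context
  fixes n k :: nat and \<Psi> :: csp
  assumes inst: "csp_instance n k \<Psi>"
begin

lemma total_weight_pos: "0 < total_weight \<Psi>"
  using inst by (simp add: csp_instance_def)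

lemma pmf_constraint:
  "pmf (constraint_pmf \<Psi>) l =
     (if l \<in> {1..num_cons \<Psi>} then weight \<Psi> l / total_weight \<Psi> else 0)"
  unfolding constraint_pmf_def
proof (rule pmf_embed_pmf)
  let ?f = "\<lambda>l. if l \<in> {1..num_cons \<Psi>} then weight \<Psi> l / total_weight \<Psi> else 0"
  have nonneg: "0 \<le> weight \<Psi> l" if "l \<in> {1..num_cons \<Psi>}" for l
    using inst that by (simp add: csp_instance_def)
  then show "0 \<le> ?f l" for l
    using total_weight_pos by auto
  have "(\<integral>\<^sup>+ l. ennreal (?f l) \<partial>count_space UNIV) = (\<Sum>l\<in>{1..num_cons \<Psi>}. ennreal (?f l))"
    by (rule nn_integral_count_space') auto
  also have "\<dots> = ennreal (\<Sum>l\<in>{1..num_cons \<Psi>}. weight \<Psi> l / total_weight \<Psi>)"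
    using nonneg total_weight_pos by (subst sum_ennreal[symmetric]) auto
  also have "(\<Sum>l\<in>{1..num_cons \<Psi>}. weight \<Psi> l / total_weight \<Psi>) = 1"
    using total_weight_pos by (simp flip: sum_divide_distrib add: total_weight_def)
  finally show "(\<integral>\<^sup>+ l. ennreal (?f l) \<partial>count_space UNIV) = 1" by simp
qed

lemma set_constraint_pmf: "set_pmf (constraint_pmf \<Psi>) \<subseteq> {1..num_cons \<Psi>}"
  by (auto simp: set_pmf_iff pmf_constraint split: if_splits)

lemma expectation_literal_pmf:
  fixes g :: "_ \<Rightarrow> real"
  shows "measure_pmf.expectation (literal_pmf k \<Psi> \<sigma>) g =
    1 / total_weight \<Psi> * (\<Sum>l\<in>{1..num_cons \<Psi>}. weight \<Psi> l * g (literals k \<Psi> \<sigma> l))"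
proof -
  have "measure_pmf.expectation (literal_pmf k \<Psi> \<sigma>) g =
    (\<Sum>l\<in>{1..num_cons \<Psi>}. pmf (constraint_pmf \<Psi>) l *\<^sub>R g (literals k \<Psi> \<sigma> l))"
    unfolding literal_pmf_def integral_map_pmf
    by (rule integral_measure_pmf) (use set_constraint_pmf in auto)
  then show ?thesis by (simp add: pmf_constraint sum_distrib_left)
qed

lemma vars_in: "l \<in> {1..num_cons \<Psi>} \<Longrightarrow> t \<in> {1..k} \<Longrightarrow> vars \<Psi> l t \<in> {1..n}"
  using inst by (auto simp: csp_instance_def PiE_iff)

lemma literals_in_cube:
  assumes "l \<in> {1..num_cons \<Psi>}" "\<And>v. v \<in> {1..n} \<Longrightarrow> \<sigma> v \<in> {-1, 1}"
  shows "literals k \<Psi> \<sigma> l \<in> cube k"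
  unfolding literals_def
proof (rule hadamard_in_cube)
  show "signs \<Psi> l \<in> cube k" using inst assms(1) by (simp add: csp_instance_def)
qed (use vars_in[OF assms(1)] assms(2) in simp)

lemma set_literal_pmf:
  assumes "\<And>v. v \<in> {1..n} \<Longrightarrow> \<sigma> v \<in> {-1, 1}"
  shows "set_pmf (literal_pmf k \<Psi> \<sigma>) \<subseteq> cube k"
  unfolding literal_pmf_def set_map_pmf
proof (rule image_subsetI)
  fix l assume "l \<in> set_pmf (constraint_pmf \<Psi>)"
  then show "literals k \<Psi> \<sigma> l \<in> cube k"
    using assms set_constraint_pmf by (intro literals_in_cube) auto
qed

text \<open>Double counting of pairs of a constraint and a position, grouped by the variable that
  occurs there.\<close>

lemma sum_literals:
  "(\<Sum>l\<in>{1..num_cons \<Psi>}. weight \<Psi> l * real_of_int (\<Sum>t\<in>{1..k}. literals k \<Psi> \<sigma> l t)) =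
   (\<Sum>v\<in>{1..n}. real_of_int (\<sigma> v) * diff k \<Psi> v)"
proof -
  let ?P = "{1..num_cons \<Psi>} \<times> {1..k}"
  let ?g = "\<lambda>(l, t). real_of_int (\<sigma> (vars \<Psi> l t)) * (real_of_int (signs \<Psi> l t) * weight \<Psi> l)"
  have "(\<Sum>l\<in>{1..num_cons \<Psi>}. weight \<Psi> l * real_of_int (\<Sum>t\<in>{1..k}. literals k \<Psi> \<sigma> l t)) =
        (\<Sum>l\<in>{1..num_cons \<Psi>}. \<Sum>t\<in>{1..k}. ?g (l, t))"
    unfolding of_int_sum sum_distrib_left
    by (intro sum.cong refl) (simp add: literals_def hadamard_def)
  also have "\<dots> = (\<Sum>x\<in>?P. ?g x)"
    by (simp add: sum.cartesian_product)
  also have "\<dots> = (\<Sum>v\<in>{1..n}. \<Sum>x\<in>{x \<in> ?P. (\<lambda>(l, t). vars \<Psi> l t) x = v}. ?g x)"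
    by (rule sum.group[symmetric]) (use vars_in in auto)
  also have "\<dots> = (\<Sum>v\<in>{1..n}. real_of_int (\<sigma> v) * diff k \<Psi> v)"
    unfolding diff_def sum_distrib_left
    by (intro sum.cong refl) auto
  finally show ?thesis .
qed

lemma mu_symmetrize_literal_pmf:
  assumes "\<And>v. v \<in> {1..n} \<Longrightarrow> \<sigma> v \<in> {-1, 1}" "1 \<le> k"
  shows "mu (symmetrize k (literal_pmf k \<Psi> \<sigma>)) =
    1 / (k * total_weight \<Psi>) * (\<Sum>v\<in>{1..n}. real_of_int (\<sigma> v) * diff k \<Psi> v)"
proof -
  have sub: "set_pmf (literal_pmf k \<Psi> \<sigma>) \<subseteq> cube k"
    using assms(1) by (rule set_literal_pmf)
  show ?thesis
    unfolding mu_symmetrize[OF sub assms(2)] expectation_literal_pmf sum_literals[symmetric]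
    by (simp add: sum_distrib_left sum_divide_distrib mult_ac)
qed

text \<open>The mean is a positive multiple of a sum over variables, and each term is largest when
  \<open>\<sigma> v\<close> has the sign of \<open>diff k \<Psi> v\<close>.\<close>

lemma mu_le_mu_majority:
  assumes "\<And>v. v \<in> {1..n} \<Longrightarrow> \<sigma> v \<in> {-1, 1}" "1 \<le> k"
  shows "mu (symmetrize k (literal_pmf k \<Psi> \<sigma>)) \<le>
    mu (symmetrize k (literal_pmf k \<Psi> (majority_assignment k \<Psi>)))"
proof -
  have "(\<Sum>v\<in>{1..n}. real_of_int (\<sigma> v) * diff k \<Psi> v) \<le>
        (\<Sum>v\<in>{1..n}. real_of_int (majority_assignment k \<Psi> v) * diff k \<Psi> v)"
    by (rule sum_mono) (use assms(1) in \<open>force simp: majority_assignment_def\<close>)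
  then show ?thesis
    using assms total_weight_pos
    by (subst (1 2) mu_symmetrize_literal_pmf)
       (auto simp: majority_assignment_def intro!: divide_right_mono)
qed

section \<open>Values of assignments in terms of symmetrized distributions\<close>

lemma csp_val_eq_expectation:
  "csp_val k f \<Psi> \<sigma> = measure_pmf.expectation (literal_pmf k \<Psi> \<sigma>) f"
  unfolding expectation_literal_pmf by (simp add: csp_val_def literals_def)

lemma csp_val_eq_gamma:
  assumes "\<And>v. v \<in> {1..n} \<Longrightarrow> \<sigma> v \<in> {-1, 1}"
  shows "csp_val k (sym_pred S k) \<Psi> \<sigma> = gamma S k (symmetrize k (literal_pmf k \<Psi> \<sigma>))"
proof -
  have sub: "set_pmf (literal_pmf k \<Psi> \<sigma>) \<subseteq> cube k"
    using assms by (rule set_literal_pmf)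
  show ?thesis
    unfolding csp_val_eq_expectation gamma_def lam_symmetrize[OF sub]
    by (rule integral_cong_AE) (use sub noisy_value_1 in \<open>auto simp: AE_measure_pmf_iff\<close>)
qed

text \<open>The variables of a constraint are distinct, so its literals receive \<open>k\<close>
  independent \<open>Bern p\<close> signs. Noise on the assignment multiplies the literals by the
  same signs.\<close>

lemma expectation_flip_literals:
  assumes "l \<in> {1..num_cons \<Psi>}"
  shows "measure_pmf.expectation (flip n p \<sigma>) (\<lambda>\<rho>. sym_pred S k (literals k \<Psi> \<rho> l)) =
    noisy_value S k p (literals k \<Psi> \<sigma> l)"
proof -
  let ?J = "vars \<Psi> l ` {1..k}"
  \<comment> \<open>outside \<open>{1..k}\<close> the index map must avoid \<open>?J\<close>, which \<open>vars\<close> itself need not do\<close>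
  define h where "h t = (if t \<in> {1..k} then vars \<Psi> l t else Suc n)" for t
  let ?B = "Pi_pmf {1..n} undefined (\<lambda>_. Bern p)"
  let ?R = "\<lambda>c v. if v \<in> ?J then c v else undefined"
  have J: "?J \<subseteq> {1..n}" using vars_in[OF assms] by auto
  have "inj_on (vars \<Psi> l) {1..k}" using inst assms by (simp add: csp_instance_def)
  then have "bij_betw (vars \<Psi> l) {1..k} ?J"
    by (rule inj_on_imp_bij_betw)
  then have "bij_betw h {1..k} ?J"
    by (rule bij_betw_cong[THEN iffD1, rotated]) (simp add: h_def)
  then have "Bern_vec k p = map_pmf (\<lambda>g. g \<circ> h) (Pi_pmf ?J undefined (\<lambda>_. Bern p))"
    unfolding Bern_vec_def using J by (intro Pi_pmf_bij_betw) (auto simp: h_def)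
  \<comment> \<open>The noise on the variables of the constraint is a marginal of the noise on all
    variables.\<close>
  also have "Pi_pmf ?J undefined (\<lambda>_. Bern p) = map_pmf ?R ?B"
    using J by (intro Pi_pmf_subset) auto
  finally have Bern: "Bern_vec k p = map_pmf (\<lambda>c. ?R c \<circ> h) ?B"
    by (simp add: pmf.map_comp comp_def)
  have had: "hadamard k (literals k \<Psi> \<sigma> l) (?R c \<circ> h) = literals k \<Psi> (\<lambda>v. \<sigma> v * c v) l" for c
    by (auto simp: literals_def hadamard_def h_def fun_eq_iff)
  have "flip n p \<sigma> = map_pmf (\<lambda>c v. if v \<in> {1..n} then \<sigma> v * c v else undefined) ?B"
    unfolding flip_def map_pmf_def by (subst Pi_pmf_bind[where d' = undefined]) simp_all
  then have "measure_pmf.expectation (flip n p \<sigma>) (\<lambda>\<rho>. sym_pred S k (literals k \<Psi> \<rho> l)) =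
     measure_pmf.expectation ?B (\<lambda>c. sym_pred S k
       (literals k \<Psi> (\<lambda>v. if v \<in> {1..n} then \<sigma> v * c v else undefined) l))"
    by simp
  also have "\<dots> = measure_pmf.expectation ?B (\<lambda>c. sym_pred S k (literals k \<Psi> (\<lambda>v. \<sigma> v * c v) l))"
  proof -
    \<comment> \<open>A constraint reads only variables in \<open>{1..n}\<close>, so the default
      value is never seen.\<close>
    have "literals k \<Psi> (\<lambda>v. if v \<in> {1..n} then \<sigma> v * c v else undefined) l =
          literals k \<Psi> (\<lambda>v. \<sigma> v * c v) l" for c
      using vars_in[OF assms] by (auto simp: literals_def hadamard_def fun_eq_iff)
    then show ?thesis by simp
  qed
  also have "\<dots> = noisy_value S k p (literals k \<Psi> \<sigma> l)"
    unfolding noisy_value_def Bern integral_map_pmf had ..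
  finally show ?thesis .
qed

lemma expectation_flip_csp_val:
  assumes "\<And>v. v \<in> {1..n} \<Longrightarrow> \<sigma> v \<in> {-1, 1}"
  shows "measure_pmf.expectation (flip n p \<sigma>) (csp_val k (sym_pred S k) \<Psi>) =
    lam S k (symmetrize k (literal_pmf k \<Psi> \<sigma>)) p"
proof -
  have int: "integrable (measure_pmf (flip n p \<sigma>))
      (\<lambda>\<rho>. sym_pred S k (literals k \<Psi> \<rho> l))" for l
    by (rule measure_pmf.integrable_const_bound[where B = 1]) (auto simp: sym_pred_def)
  have "csp_val k (sym_pred S k) \<Psi> = (\<lambda>\<rho>. 1 / total_weight \<Psi> *
      (\<Sum>l\<in>{1..num_cons \<Psi>}. weight \<Psi> l * sym_pred S k (literals k \<Psi> \<rho> l)))"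
    by (simp add: csp_val_def literals_def fun_eq_iff)
  then have "measure_pmf.expectation (flip n p \<sigma>) (csp_val k (sym_pred S k) \<Psi>) =
    1 / total_weight \<Psi> * (\<Sum>l\<in>{1..num_cons \<Psi>}. weight \<Psi> l *
      measure_pmf.expectation (flip n p \<sigma>) (\<lambda>\<rho>. sym_pred S k (literals k \<Psi> \<rho> l)))"
    by (simp add: Bochner_Integration.integral_sum int)
  also have "\<dots> = measure_pmf.expectation (literal_pmf k \<Psi> \<sigma>) (noisy_value S k p)"
    by (simp add: expectation_flip_literals expectation_literal_pmf)
  also have "\<dots> = lam S k (symmetrize k (literal_pmf k \<Psi> \<sigma>)) p"
    using assms by (intro lam_symmetrize[symmetric] set_literal_pmf)
  finally show ?thesis .
qed

end

section \<open>The approximation guarantee\<close>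

theorem theorem7p7:
  fixes i k n :: nat and p :: real and \<Psi> :: csp
  assumes "1 \<le> i" and "i \<le> k"
    and "p \<in> {0..1}"
    and "alpha {i..k} k = (INF DN\<in>Delta k. ratio (lam {i..k} k DN p) (gamma_mu {i..k} k (mu DN)))"
    and "csp_instance n k \<Psi>"
  shows "ereal (measure_pmf.expectation (rounding n k p \<Psi>) (csp_val k (Th i k) \<Psi>))
           \<ge> alpha {i..k} k * ereal (csp_max_val n k (Th i k) \<Psi>)"
proof -
  let ?S = "{i..k}"
  define D where "D \<sigma> = symmetrize k (literal_pmf k \<Psi> \<sigma>)" for \<sigma>
  define DN where "DN = D (majority_assignment k \<Psi>)"
  let ?val = "csp_max_val n k (sym_pred ?S k) \<Psi>"
  let ?g = "gamma_mu ?S k (mu DN)"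
  note inst = assms(5)
  have k: "1 \<le> k" using assms(1,2) by simp
  have maj: "majority_assignment k \<Psi> v \<in> {-1, 1}" for v
    by (simp add: majority_assignment_def)
  have D_Delta: "D \<sigma> \<in> Delta k" if "\<And>v. v \<in> {1..n} \<Longrightarrow> \<sigma> v \<in> {-1, 1}" for \<sigma>
    unfolding D_def using that by (intro symmetrize_in_Delta set_literal_pmf[OF inst])
  have DN_Delta: "DN \<in> Delta k" unfolding DN_def using maj by (intro D_Delta)
  have expect: "measure_pmf.expectation (rounding n k p \<Psi>) (csp_val k (sym_pred ?S k) \<Psi>) =
      lam ?S k DN p"
    unfolding rounding_eq_flip DN_def D_def using maj by (intro expectation_flip_csp_val[OF inst])
  \<comment> \<open>Nonemptiness and finiteness ensure that the maximum is attained by some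
    assignment.\<close>
  have "cube n \<noteq> {}" using all_ones_in_cube by blast
  then have "?val \<in> csp_val k (sym_pred ?S k) \<Psi> ` cube n"
    unfolding csp_max_val_def by (intro Max_in) (simp_all add: finite_cube)
  then obtain \<sigma> where "\<sigma> \<in> cube n" and val: "?val = csp_val k (sym_pred ?S k) \<Psi> \<sigma>" by blast
  then have \<sigma>: "\<sigma> v \<in> {-1, 1}" if "v \<in> {1..n}" for v
    using that cube_val by blast
  have val_eq: "?val = gamma ?S k (D \<sigma>)"
    unfolding val D_def using \<sigma> by (rule csp_val_eq_gamma[OF inst])
  have val_nonneg: "0 \<le> ?val"
    unfolding val_eq gamma_def by (rule lam_nonneg)
  have val_le: "?val \<le> ?g"
    unfolding val_eq
  proof (rule gamma_le_gamma_mu_mono)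
    show "mu (D \<sigma>) \<le> mu DN"
      unfolding D_def DN_def using \<sigma> k by (rule mu_le_mu_majority[OF inst])
    show "mu DN \<le> 1" using DN_Delta k by (intro mu_le_1 set_pmf_Delta)
  qed (use D_Delta \<sigma> assms(2) k in auto)
  have "alpha ?S k * ereal ?val \<le> ereal (lam ?S k DN p)"
  proof (cases "?g = 0")
    case True
    \<comment> \<open>The ratio at \<open>DN\<close> is infinite here and bounds nothing, but in
      \<open>ereal\<close> any factor times \<open>0\<close> is \<open>0\<close>, even an infinite
      one.\<close>
    then have "?val = 0" using val_nonneg val_le by simp
    then show ?thesis using lam_nonneg by (simp flip: zero_ereal_def)
  next
    case False
    then have g: "0 < ?g" using val_nonneg val_le by simp
    \<comment> \<open>\<open>DN\<close> is one candidate in the infimum assumed for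
      \<open>p\<close>.\<close>
    have "alpha ?S k \<le> ratio (lam ?S k DN p) ?g"
      unfolding assms(4) using DN_Delta by (rule INF_lower)
    then have "alpha ?S k * ereal ?val \<le> ereal (lam ?S k DN p / ?g) * ereal ?val"
      using False val_nonneg by (intro ereal_mult_right_mono) (auto simp: ratio_def)
    \<comment> \<open>The ratio is nonnegative, so replacing \<open>?val\<close> by the larger
      \<open>?g\<close> cancels the denominator.\<close>
    also have "\<dots> \<le> ereal (lam ?S k DN p)"
      using mult_left_mono[OF val_le lam_nonneg[of ?S k DN p]] g by (simp add: field_simps)
    finally show ?thesis .
  qed
  then show ?thesis unfolding Th_eq_sym_pred expect .
qed

end
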